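(* Let $\tau\in\mathbb{C}$ with $\mathrm{Im}(\tau)>0$, $q=e^{2i\pi\tau}$ (with $q^{s}=e^{2i\pi\tau s}$), and $\varphi(z,\tau)=-\frac{1}{16\pi^2}\tilde\wp_\tau(z)$. Then for every $z\in\mathbb{C}\setminus\left(\frac{1+\tau}{2}+\mathbb{Z}+\tau\mathbb{Z}\right)$, $$\varphi(z,\tau)=\sin(\pi z)^2\,q^{1/2}\prod_{n=0}^{+\infty}(1-q^{2n+2})^4(1-q^{n+1/2})^4\left(\prod_{n=0}^{+\infty}\frac{\left(1-e^{2i\pi z}q^{n+1}\right)\left(1-e^{-2i\pi z}q^{n+1}\right)}{\left(1+e^{2i\pi z}q^{n+1/2}\right)\left(1+e^{-2i\pi z}q^{n+1/2}\right)}\right)^2.$$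
   Context: For $\mathrm{Im}(\tau)>0$, $\tilde\wp_\tau$ is the meromorphic function $$\tilde\wp_\tau(z)=\sum_{(n,m)\in\mathbb{Z}^2}\left(\frac{1}{(z+(n+\frac12)+(m+\frac12)\tau)^2}-\frac{1}{((n+\frac12)+(m+\frac12)\tau)^2}\right).$$ *)

theory Defs
  imports "HOL-Analysis.Analysis"
begin

text \<open>
  The lattice sum is an unordered (equivalently, absolutely convergent) sum over all pairs of
  integers.  Its poles form the coset \<open>(1+\<tau>)/2 + \<int> + \<tau>\<int>\<close>; only there do its values depend on the
  convention \<open>1/0 = 0\<close>.
\<close>
definition wp_tilde :: "complex \<Rightarrow> complex \<Rightarrow> complex" where
  "wp_tilde \<tau> z =
     (\<Sum>\<^sub>\<infinity>(n, m)\<in>(UNIV :: (int \<times> int) set).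
        1 / (z + (of_int n + 1/2) + (of_int m + 1/2) * \<tau>)\<^sup>2
          - 1 / ((of_int n + 1/2) + (of_int m + 1/2) * \<tau>)\<^sup>2)"

definition phi :: "complex \<Rightarrow> complex \<Rightarrow> complex" where
  "phi z \<tau> = - (1 / (16 * (complex_of_real pi)\<^sup>2)) * wp_tilde \<tau> z"

text \<open>
  The power \<open>q\<^sup>s\<close> of the nome \<open>q = exp (2 i \<pi> \<tau>)\<close>, with the branch determined by \<open>\<tau>\<close>.
\<close>
definition qpow :: "complex \<Rightarrow> real \<Rightarrow> complex" where
  "qpow \<tau> s = exp (2 * \<i> * complex_of_real pi * \<tau> * complex_of_real s)"

end

theory Submission
  imports Defs "HOL-Complex_Analysis.Complex_Analysis"
begin

text \<open>
  Summing the lattice series over rows with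
  \<open>\<Sum>n. 1 / (u + n)\<^sup>2 = pi\<^sup>2 / sin (pi * u) ^ 2\<close> turns \<open>phi\<close> into a bilateral series in
  \<open>x = exp (2 * \<i> * pi * z)\<close>. Both this series and the product are invariant under \<open>x \<mapsto> q * x\<close> and
  \<open>x \<mapsto> 1 / x\<close>, and their only singularities are double poles on the coset \<open>(1+\<tau>)/2 + \<int> + \<tau>\<int>\<close>
  with the same leading coefficient. Their difference is even about a pole, so it has no simple
  pole either; by Liouville's theorem it is constant, and it vanishes at \<open>z = 0\<close>.
\<close>

subsection \<open>The \<open>q\<close>-Pochhammer symbol\<close>

text \<open>Everything is written in the nome \<open>s = exp (\<i> * of_real pi * \<tau>)\<close>:
  then q is s^2, half-integral powers of q are odd powers of \<open>s\<close>, and no branch has to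
  be chosen. The real shift 1/2 of the lattice turns 1 / sin^2 into x / (1 + x)^2, so the series has
  its poles at x = -s^k with k odd, which are the zeros of the denominator of the product. The
  delicate point is the constant. Write (a; q) for \<open>qpoch q a\<close>. At x = -s, matching the
  double poles forces the constant C in front of the product to satisfy C * (-s; q)^4 = (q; q)^4.
  The constant of the theorem, C = ((q^2; q^2) * (s; q))^4, does so because (q^2; q^2) * (s; q) *
  (-s; q) = (q; q). Laurent expansions are avoided: the difference is multiplied by (1 + s/x)^2,
  which leaves a function continuous at -s, and the matching of coefficients becomes the vanishing
  of that function at -s.\<close>

definition qpoch :: "complex \<Rightarrow> complex \<Rightarrow> complex" where
  "qpoch q a = (\<Prod>n. 1 - a * q ^ n)"

lemma norm_power2_less_one:
  fixes s :: complex
  shows "norm s < 1 \<Longrightarrow> norm (s\<^sup>2) < 1"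
  by (simp add: norm_power power_less_one_iff)

lemma convergent_prod_qpoch:
  assumes "norm q < 1"
  shows "convergent_prod (\<lambda>n. 1 - a * q ^ n :: complex)"
  by (intro abs_convergent_prod_imp_convergent_prod summable_imp_abs_convergent_prod)
     (use assms in \<open>simp add: norm_mult norm_power\<close>)

lemma qpoch_LIMSEQ:
  assumes "norm q < 1"
  shows "(\<lambda>n. \<Prod>k<n. 1 - a * q ^ k) \<longlonglongrightarrow> qpoch q a"
  using convergent_prod_LIMSEQ[OF convergent_prod_qpoch[OF assms]]
  unfolding qpoch_def LIMSEQ_lessThan_iff_atMost .

text \<open>Splitting off the factor n = 0. All transformation laws of the product, and the
  isolation of its pole, come from this one identity.\<close>

lemma qpoch_rec:
  assumes "norm q < 1"
  shows "qpoch q a = (1 - a) * qpoch q (a * q)"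
proof (rule LIMSEQ_unique)
  show "(\<lambda>n. \<Prod>k<Suc n. 1 - a * q ^ k) \<longlonglongrightarrow> qpoch q a"
    using qpoch_LIMSEQ[OF assms] by (rule LIMSEQ_Suc)
  have "(\<lambda>n. (1 - a) * (\<Prod>k<n. 1 - a * q * q ^ k)) \<longlonglongrightarrow> (1 - a) * qpoch q (a * q)"
    by (intro tendsto_intros qpoch_LIMSEQ assms)
  also have "(\<lambda>n. (1 - a) * (\<Prod>k<n. 1 - a * q * q ^ k)) = (\<lambda>n. \<Prod>k<Suc n. 1 - a * q ^ k)"
    by (simp only: prod.lessThan_Suc_shift) (simp add: mult_ac)
  finally show "(\<lambda>n. \<Prod>k<Suc n. 1 - a * q ^ k) \<longlonglongrightarrow> (1 - a) * qpoch q (a * q)" .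
qed

lemma qpoch_nonzero:
  assumes "norm q < 1" "\<And>n. a * q ^ n \<noteq> 1"
  shows "qpoch q a \<noteq> 0"
  unfolding qpoch_def
  by (rule prodinf_nonzero[OF convergent_prod_qpoch[OF assms(1)]])
     (metis assms(2) eq_iff_diff_eq_0)

text \<open>The partial products converge uniformly on every closed disc of radius 1, by the M-test
  with the geometric majorant (|z| + 1) * |q|^n.\<close>

lemma qpoch_holomorphic:
  assumes "norm q < 1"
  shows "qpoch q holomorphic_on UNIV"
proof (rule holomorphic_uniform_sequence)
  let ?P = "\<lambda>n a. \<Prod>k<n. 1 - a * q ^ k"
  fix z :: complex
  have "uniformly_convergent_on (cball z 1) ?P"
  proof (rule uniformly_convergent_on_prod')
    show "uniformly_convergent_on (cball z 1) (\<lambda>N a. \<Sum>n<N. norm (1 - a * q ^ n - 1))"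
    proof (rule Weierstrass_m_test')
      fix n a assume "a \<in> cball z 1"
      hence "norm a \<le> norm z + 1"
        using norm_triangle_ineq4[of z "z - a"] by (simp add: dist_norm)
      thus "norm (norm (1 - a * q ^ n - 1)) \<le> (norm z + 1) * norm q ^ n"
        by (simp add: norm_mult norm_power mult_right_mono)
    qed (use assms in \<open>auto intro!: summable_mult\<close>)
  qed (auto intro!: continuous_intros)
  then obtain g where g: "uniform_limit (cball z 1) ?P g sequentially"
    by (auto simp: uniformly_convergent_on_def)
  have "g a = qpoch q a" if "a \<in> cball z 1" for a
    using tendsto_uniform_limitI[OF g that] qpoch_LIMSEQ[OF assms] LIMSEQ_unique by blast
  hence "uniform_limit (cball z 1) ?P (qpoch q) sequentially"
    using g uniform_limit_cong'[of "cball z 1" ?P ?P g "qpoch q"] by simp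
  thus "\<exists>d>0. cball z d \<subseteq> UNIV \<and> uniform_limit (cball z d) ?P (qpoch q) sequentially"
    by (intro exI[of _ 1]) auto
qed (auto intro!: holomorphic_intros)

lemma qpoch_analytic_compose:
  assumes "norm q < 1" "f analytic_on A"
  shows "(\<lambda>z. qpoch q (f z)) analytic_on A"
  using analytic_on_compose_gen[OF assms(2), of "qpoch q" UNIV] qpoch_holomorphic[OF assms(1)]
  by (simp add: o_def analytic_on_open)

lemma qpoch_one: "norm q < 1 \<Longrightarrow> qpoch q 1 = 0"
  using qpoch_rec[of q 1] by simp

text \<open>Sort the factors 1 - q^j, j >= 1, by the parity of j. The finite products agree exactly
  only for even length, hence the passage to the subsequence 2n.\<close>

lemma qpoch_split_square:
  assumes "norm q < 1"
  shows "qpoch q q = qpoch (q\<^sup>2) q * qpoch (q\<^sup>2) (q\<^sup>2)"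
proof (rule LIMSEQ_unique)
  note q2 = norm_power2_less_one[OF assms]
  have "(\<lambda>n. (\<Prod>k<n. 1 - q * (q\<^sup>2) ^ k) * (\<Prod>k<n. 1 - q\<^sup>2 * (q\<^sup>2) ^ k)) \<longlonglongrightarrow>
          qpoch (q\<^sup>2) q * qpoch (q\<^sup>2) (q\<^sup>2)"
    by (intro tendsto_intros qpoch_LIMSEQ q2)
  also have "(\<lambda>n. (\<Prod>k<n. 1 - q * (q\<^sup>2) ^ k) * (\<Prod>k<n. 1 - q\<^sup>2 * (q\<^sup>2) ^ k)) =
               (\<lambda>n. \<Prod>k<2 * n. 1 - q * q ^ k)"
  proof
    fix n
    show "(\<Prod>k<n. 1 - q * (q\<^sup>2) ^ k) * (\<Prod>k<n. 1 - q\<^sup>2 * (q\<^sup>2) ^ k) = (\<Prod>k<2 * n. 1 - q * q ^ k)"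
      by (induction n) (simp_all add: power_mult power2_eq_square power_mult_distrib mult_ac)
  qed
  finally show "(\<lambda>n. \<Prod>k<2 * n. 1 - q * q ^ k) \<longlonglongrightarrow> qpoch (q\<^sup>2) q * qpoch (q\<^sup>2) (q\<^sup>2)" .
  show "(\<lambda>n. \<Prod>k<2 * n. 1 - q * q ^ k) \<longlonglongrightarrow> qpoch q q"
    using LIMSEQ_subseq_LIMSEQ[OF qpoch_LIMSEQ[OF assms, of q], of "\<lambda>n. 2 * n"]
    by (simp add: o_def strict_mono_def)
qed

lemma qpoch_mult_uminus:
  assumes "norm q < 1"
  shows "qpoch q a * qpoch q (- a) = qpoch (q\<^sup>2) (a\<^sup>2)"
proof -
  have "qpoch q a * qpoch q (- a) = (\<Prod>n. (1 - a * q ^ n) * (1 - (- a) * q ^ n))"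
    unfolding qpoch_def by (intro prodinf_mult convergent_prod_qpoch assms)
  also have "(\<lambda>n. (1 - a * q ^ n) * (1 - (- a) * q ^ n)) = (\<lambda>n. 1 - a\<^sup>2 * (q\<^sup>2) ^ n)"
    by (auto simp: algebra_simps power2_eq_square power_mult_distrib)
  finally show ?thesis by (simp add: qpoch_def)
qed

text \<open>This makes the leading coefficients at the double pole agree. With q = s^2, the
  difference of squares gives (s; q) * (-s; q) = (q; q^2), and the parity splitting completes it to
  (q; q).\<close>

lemma qpoch_uminus_product:
  assumes "norm s < 1"
  shows "qpoch (s\<^sup>2 * s\<^sup>2) (s\<^sup>2 * s\<^sup>2) * qpoch (s\<^sup>2) s * qpoch (s\<^sup>2) (- s) = qpoch (s\<^sup>2) (s\<^sup>2)"
proof -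
  note q = norm_power2_less_one[OF assms]
  show ?thesis
    using qpoch_split_square[OF q] qpoch_mult_uminus[OF q, of s]
    by (simp add: power2_eq_square[of "s\<^sup>2"] mult_ac)
qed

subsection \<open>The bilateral series\<close>

text \<open>The Koebe function rotated so that its pole is at -1: up to the factor 4 it is 1 / sin^2
  in an exponential variable.\<close>

definition koebe :: "complex \<Rightarrow> complex" where
  "koebe x = x / (1 + x)\<^sup>2"

definition koebe_series :: "complex \<Rightarrow> complex \<Rightarrow> complex" where
  "koebe_series q a = (\<Sum>n. koebe (a * q ^ n))"

text \<open>The evenness of 1 / sin^2 in the exponential variable. The convention for division by
  zero makes it hold at 0 and -1 too, so it can be used later without side conditions.\<close>

lemma koebe_inverse: "koebe (inverse x) = koebe x"
proof (cases "x = 0")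
  case False
  hence "1 + inverse x = (1 + x) / x" by (simp add: field_simps)
  thus ?thesis using False
    by (cases "1 + x = 0") (simp_all add: koebe_def field_simps power2_eq_square)
qed (simp add: koebe_def)

lemma norm_koebe_le:
  assumes "norm x \<le> 1 / 2"
  shows "norm (koebe x) \<le> 4 * norm x"
proof -
  have "1 / 2 \<le> norm (1 + x)"
    using norm_triangle_ineq2[of 1 "- x"] assms by simp
  hence "(1 / 2) ^ 2 \<le> norm (1 + x) ^ 2"
    by (intro power_mono) auto
  hence "norm x / norm (1 + x) ^ 2 \<le> norm x / (1 / 2) ^ 2"
    by (intro divide_left_mono) (auto simp: power2_eq_square)
  thus ?thesis by (simp add: koebe_def norm_divide norm_power power2_eq_square norm_mult mult_ac)
qed

lemma eventually_norm_mult_power_le: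
  fixes q :: complex
  assumes "norm q < 1" "e > 0"
  shows "eventually (\<lambda>n. B * norm q ^ n \<le> e) sequentially"
proof -
  have "(\<lambda>n. B * norm q ^ n) \<longlonglongrightarrow> B * 0"
    by (intro tendsto_intros LIMSEQ_power_zero) (use assms in auto)
  hence "eventually (\<lambda>n. B * norm q ^ n < e) sequentially"
    by (rule order_tendstoD) (use assms in auto)
  thus ?thesis by eventually_elim simp
qed

lemma summable_norm_koebe:
  assumes "norm q < 1"
  shows "summable (\<lambda>n. norm (koebe (a * q ^ n)))"
proof (rule summable_comparison_test_ev)
  show "eventually (\<lambda>n. norm (norm (koebe (a * q ^ n))) \<le> 4 * norm a * norm q ^ n) sequentially"
    using eventually_norm_mult_power_le[OF assms, of "1/2" "norm a", simplified]
  proof eventually_elim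
    case (elim n)
    thus ?case using norm_koebe_le[of "a * q ^ n"] by (simp add: norm_mult norm_power)
  qed
  show "summable (\<lambda>n. 4 * norm a * norm q ^ n)"
    by (intro summable_mult summable_geometric) (use assms in auto)
qed

lemma has_sum_koebe_series:
  assumes "norm q < 1"
  shows "((\<lambda>n. koebe (a * q ^ n)) has_sum koebe_series q a) UNIV"
  unfolding koebe_series_def
  by (intro norm_summable_imp_has_sum summable_norm_koebe[OF assms] summable_sums
      summable_norm_cancel[OF summable_norm_koebe[OF assms]])

lemma koebe_series_split:
  assumes "norm q < 1"
  shows "koebe_series q a = (\<Sum>k<n. koebe (a * q ^ k)) + koebe_series q (a * q ^ n)"
  unfolding koebe_series_def
  using suminf_split_initial_segment[OF summable_norm_cancel[OF summable_norm_koebe[OF assms]], of a n]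
  by (simp add: power_add mult_ac)

lemma koebe_series_rec:
  assumes "norm q < 1"
  shows "koebe_series q a = koebe a + koebe_series q (a * q)"
  using koebe_series_split[OF assms, of a 1] by simp

text \<open>On this disc |a * q^n| stays below 1/2, so no term has a pole and
  \<open>norm_koebe_le\<close> supplies a geometric majorant.\<close>

lemma koebe_series_holomorphic_ball:
  assumes "norm q < 1"
  shows "koebe_series q holomorphic_on ball 0 (1/2)"
proof (rule holomorphic_uniform_sequence)
  let ?P = "\<lambda>n a. \<Sum>k<n. koebe (a * q ^ k)"
  have le: "norm (a * q ^ n) \<le> norm a" for a n
    using assms by (simp add: norm_mult norm_power mult_left_le power_le_one)
  show "?P n holomorphic_on ball 0 (1/2)" for n
  proof -
    have "1 + a * q ^ k \<noteq> 0" if "a \<in> ball 0 (1/2)" for a k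
    proof
      assume "1 + a * q ^ k = 0"
      hence "norm (a * q ^ k) = 1"
        by (metis add.commute add_eq_0_iff norm_minus_cancel norm_one)
      thus False using le[of a k] that by simp
    qed
    thus ?thesis unfolding koebe_def by (auto intro!: holomorphic_intros)
  qed
  have ul: "uniform_limit (ball 0 (1/2)) ?P (koebe_series q) sequentially"
    unfolding koebe_series_def
  proof (rule Weierstrass_m_test)
    fix n a assume a: "a \<in> ball (0::complex) (1/2)"
    have "norm (koebe (a * q ^ n)) \<le> 4 * norm (a * q ^ n)"
      by (rule norm_koebe_le) (use le[of a n] a in simp)
    also have "\<dots> \<le> 4 * (1 / 2) * norm q ^ n"
      unfolding norm_mult norm_power mult.assoc
      by (intro mult_left_mono mult_right_mono) (use a in auto)
    finally show "norm (koebe (a * q ^ n)) \<le> 4 * (1 / 2) * norm q ^ n" .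
  qed (intro summable_mult summable_geometric, use assms in auto)
  fix z :: complex assume "z \<in> ball 0 (1/2)"
  then obtain d where d: "d > 0" "cball z d \<subseteq> ball 0 (1/2)"
    using open_contains_cball[of "ball (0::complex) (1/2)"] open_ball by metis
  show "\<exists>d>0. cball z d \<subseteq> ball 0 (1/2) \<and> uniform_limit (cball z d) ?P (koebe_series q) sequentially"
    by (intro exI[of _ d] conjI d uniform_limit_on_subset[OF ul])
qed auto

text \<open>Splitting off enough initial terms moves the argument to a * q^n inside the disc of
  radius 1/2; the finite head is rational, and the hypothesis keeps its poles away from
  \<open>a\<close>.\<close>

lemma koebe_series_analytic_at:
  assumes "norm q < 1" "\<And>n. a * q ^ n \<noteq> -1"
  shows "koebe_series q analytic_on {a}"
proof -
  define R where "R = norm a + 1"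
  obtain n where n: "R * norm q ^ n \<le> 1/4"
    using eventually_norm_mult_power_le[OF assms(1), of "1/4" R]
    by (auto simp: eventually_sequentially)
  have "(\<lambda>b. koebe_series q (b * q ^ n)) analytic_on {a}"
  proof -
    have "koebe_series q analytic_on {a * q ^ n}"
    proof (rule analytic_on_subset)
      show "koebe_series q analytic_on ball 0 (1/2)"
        using koebe_series_holomorphic_ball[OF assms(1)] by (simp add: analytic_on_open)
      have "norm a * norm q ^ n \<le> R * norm q ^ n"
        by (intro mult_right_mono) (auto simp: R_def)
      thus "{a * q ^ n} \<subseteq> ball 0 (1/2)" using n by (simp add: norm_mult norm_power)
    qed
    moreover have "(\<lambda>b. b * q ^ n) analytic_on {a}" by (intro analytic_intros)
    ultimately show ?thesis
      using analytic_on_compose_gen[of "\<lambda>b. b * q ^ n" "{a}" "koebe_series q" "{a * q ^ n}"]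
      by (simp add: o_def)
  qed
  moreover have "(\<lambda>b. \<Sum>k<n. koebe (b * q ^ k)) analytic_on {a}"
    unfolding koebe_def using assms(2)
    by (intro analytic_intros) (auto simp: add_eq_0_iff)
  ultimately have "(\<lambda>b. (\<Sum>k<n. koebe (b * q ^ k)) + koebe_series q (b * q ^ n)) analytic_on {a}"
    by (rule analytic_on_add[rotated])
  also have "(\<lambda>b. (\<Sum>k<n. koebe (b * q ^ k)) + koebe_series q (b * q ^ n)) = koebe_series q"
    by (rule ext) (rule koebe_series_split[OF assms(1), symmetric])
  finally show ?thesis .
qed

lemma koebe_series_analytic_compose:
  assumes "norm q < 1" "f analytic_on {z}" "\<And>n. f z * q ^ n \<noteq> -1"
  shows "(\<lambda>z. koebe_series q (f z)) analytic_on {z}"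
  using analytic_on_compose_gen[OF assms(2), of "koebe_series q" "{f z}"] koebe_series_analytic_at[OF assms(1), of "f z"] assms(3)
  by (simp add: o_def)

subsection \<open>Summation of the lattice series over rows\<close>

text \<open>The negative integers are enumerated as -1 - n because this reflection negates n + 1/2;
  the two halves of a sum over half-integers thus mirror each other.\<close>

lemma has_sum_int:
  fixes f :: "int \<Rightarrow> 'a :: topological_comm_monoid_add"
  assumes "((\<lambda>n::nat. f (int n)) has_sum a) UNIV" "((\<lambda>n::nat. f (- 1 - int n)) has_sum b) UNIV"
  shows "(f has_sum (a + b)) UNIV"
proof -
  have "(f has_sum a) {0..}"
    using assms(1) by (subst has_sum_reindex_bij_witness[of _ int nat]) auto
  moreover have "(f has_sum b) {..<0}"
    using assms(2)
    by (subst has_sum_reindex_bij_witness[of _ "\<lambda>n. - 1 - int n" "\<lambda>k. nat (- 1 - k)"]) auto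
  ultimately have "(f has_sum (a + b)) ({0..} \<union> {..<0})"
    by (rule has_sum_Un_disjoint) auto
  also have "{0..} \<union> {..<0} = (UNIV :: int set)" by auto
  finally show ?thesis .
qed

text \<open>Differentiate both sides of Gamma(z) * Gamma(1 - z) = pi / sin(pi * z) and divide by the
  product.\<close>

lemma Digamma_reflection:
  assumes "z \<notin> \<int>"
  shows "Digamma z - Digamma (1 - z) = - of_real pi * cos (of_real pi * z) / sin (of_real pi * z :: complex)"
proof -
  let ?s = "sin (of_real pi * z)" and ?G = "Gamma z * Gamma (1 - z)"
  have ne: "?s \<noteq> 0" using assms by (auto simp: sin_eq_0)
  have nz: "z \<notin> \<int>\<^sub>\<le>\<^sub>0" "1 - z \<notin> \<int>\<^sub>\<le>\<^sub>0"
    using assms nonpos_Ints_subset_Ints Ints_diff[OF Ints_1, of "1 - z"] by auto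
  have "((\<lambda>z. Gamma z * Gamma (1 - z)) has_field_derivative ?G * (Digamma z - Digamma (1 - z))) (at z)"
    by (auto intro!: derivative_eq_intros nz simp: algebra_simps)
  moreover have "((\<lambda>z. Gamma z * Gamma (1 - z)) has_field_derivative
      - (of_real pi * (of_real pi * cos (of_real pi * z))) / ?s\<^sup>2) (at z)"
    unfolding Gamma_reflection_complex
    by (auto intro!: derivative_eq_intros simp: ne power2_eq_square)
  ultimately have "?G * (Digamma z - Digamma (1 - z)) =
      - (of_real pi * (of_real pi * cos (of_real pi * z))) / ?s\<^sup>2"
    by (rule DERIV_unique)
  hence "of_real pi * ((Digamma z - Digamma (1 - z)) * ?s) = of_real pi * (- of_real pi * cos (of_real pi * z))"
    unfolding Gamma_reflection_complex using ne by (simp add: divide_simps power2_eq_square mult_ac)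
  hence "(Digamma z - Digamma (1 - z)) * ?s = - of_real pi * cos (of_real pi * z)"
    by (subst (asm) mult_left_cancel) auto
  thus ?thesis by (rule eq_divide_imp[OF ne])
qed

text \<open>The derivative of \<open>Digamma_reflection\<close>, which may be taken because the
  complement of the integers is open. It evaluates the bilateral sum of inverse squares.\<close>

lemma Trigamma_reflection:
  assumes "z \<notin> \<int>"
  shows "Polygamma 1 z + Polygamma 1 (1 - z) = of_real pi ^ 2 / sin (of_real pi * z :: complex) ^ 2"
proof -
  let ?s = "sin (of_real pi * z)"
  have ne: "?s \<noteq> 0" using assms by (auto simp: sin_eq_0)
  have nz: "z \<notin> \<int>\<^sub>\<le>\<^sub>0" "1 - z \<notin> \<int>\<^sub>\<le>\<^sub>0"
    using assms nonpos_Ints_subset_Ints Ints_diff[OF Ints_1, of "1 - z"] by auto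
  have sc: "cos (z * of_real pi) * cos (z * of_real pi) = 1 - sin (z * of_real pi) * sin (z * of_real pi)"
    by (simp add: eq_diff_eq)
  have "((\<lambda>z. - of_real pi * cos (of_real pi * z) / sin (of_real pi * z)) has_field_derivative
          of_real pi ^ 2 / ?s\<^sup>2) (at z)"
    by (rule derivative_eq_intros refl ne)+
       (simp add: ne power2_eq_square, simp add: algebra_simps sc)
  hence "((\<lambda>z. Digamma z - Digamma (1 - z)) has_field_derivative of_real pi ^ 2 / ?s\<^sup>2) (at z)"
    by (rule has_field_derivative_transform_within_open[of _ _ _ "- \<int>"])
       (use assms closed_Ints Digamma_reflection in \<open>auto simp: open_Compl\<close>)
  moreover have "((\<lambda>z. Digamma z - Digamma (1 - z)) has_field_derivative
      (Polygamma 1 z + Polygamma 1 (1 - z))) (at z)"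
    by (auto intro!: derivative_eq_intros nz)
  ultimately show ?thesis by (rule DERIV_unique[symmetric])
qed

text \<open>An unordered sum needs absolute convergence on top of the known ordered series; it
  follows from |z + n| >= n/2 once n >= 2|z|.\<close>

lemma has_sum_Trigamma:
  fixes z :: complex
  assumes "z \<notin> \<int>\<^sub>\<le>\<^sub>0"
  shows "((\<lambda>n::nat. 1 / (z + of_nat n)\<^sup>2) has_sum Polygamma 1 z) UNIV"
proof (rule norm_summable_imp_has_sum)
  have "z \<noteq> 0" using assms by auto
  thus "(\<lambda>n::nat. 1 / (z + of_nat n)\<^sup>2) sums Polygamma 1 z"
    using Polygamma_LIMSEQ[of z 1] by (simp add: inverse_eq_divide power2_eq_square)
  show "summable (\<lambda>n. norm (1 / (z + of_nat n)\<^sup>2))"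
  proof (rule summable_comparison_test_ev)
    show "summable (\<lambda>n. 4 * inverse (real n ^ 2))"
      by (intro summable_mult inverse_power_summable) auto
    show "eventually (\<lambda>n. norm (norm (1 / (z + of_nat n)\<^sup>2)) \<le> 4 * inverse (real n ^ 2)) sequentially"
      using eventually_gt_at_top[of "nat \<lceil>2 * norm z\<rceil>"]
    proof eventually_elim
      case (elim n)
      hence n: "2 * norm z \<le> real n" "n > 0" by linarith+
      have "real n / 2 \<le> norm (z + of_nat n)"
        using norm_triangle_ineq2[of "of_nat n" "- z"] n by (simp add: add.commute)
      hence "(real n / 2) ^ 2 \<le> norm (z + of_nat n) ^ 2"
        by (intro power_mono) auto
      hence "1 / norm (z + of_nat n) ^ 2 \<le> 1 / (real n / 2) ^ 2"
        by (rule divide_left_mono) (use n \<open>real n / 2 \<le> _\<close> in \<open>auto intro!: mult_pos_pos\<close>)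
      thus ?case by (simp add: norm_divide norm_power power_divide inverse_eq_divide)
    qed
  qed
qed

lemma has_sum_inverse_square_int:
  fixes z :: complex
  assumes "z \<notin> \<int>"
  shows "((\<lambda>n::int. 1 / (z + of_int n)\<^sup>2) has_sum (of_real pi ^ 2 / sin (of_real pi * z) ^ 2)) UNIV"
proof -
  have nz: "z \<notin> \<int>\<^sub>\<le>\<^sub>0" "1 - z \<notin> \<int>\<^sub>\<le>\<^sub>0"
    using assms nonpos_Ints_subset_Ints Ints_diff[OF Ints_1, of "1 - z"] by auto
  have "(\<lambda>n::nat. 1 / (z + of_int (- 1 - int n))\<^sup>2) = (\<lambda>n. 1 / (1 - z + of_nat n)\<^sup>2)"
  proof
    fix n
    have "z + of_int (- 1 - int n) = - (1 - z + of_nat n)" by simp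
    thus "1 / (z + of_int (- 1 - int n))\<^sup>2 = 1 / (1 - z + of_nat n)\<^sup>2" by (simp only: power2_minus)
  qed
  hence "((\<lambda>n::nat. 1 / (z + of_int (- 1 - int n))\<^sup>2) has_sum Polygamma 1 (1 - z)) UNIV"
    using has_sum_Trigamma[OF nz(2)] by simp
  moreover have "((\<lambda>n::nat. 1 / (z + of_int (int n))\<^sup>2) has_sum Polygamma 1 z) UNIV"
    using has_sum_Trigamma[OF nz(1)] by simp
  ultimately show ?thesis
    using has_sum_int[of "\<lambda>n. 1 / (z + of_int n)\<^sup>2"] Trigamma_reflection[OF assms] by metis
qed

lemma sin_squared_conv_exp:
  "(sin z)\<^sup>2 = - ((1 - exp (2 * \<i> * z))\<^sup>2 / (4 * exp (2 * \<i> * z)))"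
proof -
  have e: "exp (2 * \<i> * z) = exp (\<i> * z) ^ 2"
      "exp (- (\<i> * z)) = 1 / exp (\<i> * z)"
    by (simp_all add: exp_double[symmetric] mult.assoc exp_minus inverse_eq_divide)
  have "sin z = (exp (\<i> * z) - 1 / exp (\<i> * z)) / (2 * \<i>)"
    by (simp add: sin_exp_eq e(2))
  thus ?thesis unfolding e(1)
    by (simp only:) (simp add: field_simps power2_eq_square)
qed

lemma inverse_sin_squared_eq_koebe:
  "1 / (sin z)\<^sup>2 = 4 * koebe (- exp (2 * \<i> * z))"
  by (simp add: sin_squared_conv_exp koebe_def)

lemma summable_on_int_powr: "(\<lambda>n::int. \<bar>of_int n + 1/2 :: real\<bar> powr (-3/2)) summable_on UNIV"
proof -
  have "((\<lambda>n. (real n + 1/2) powr (-3/2)) has_sum (\<Sum>n. (real n + 1/2) powr (-3/2))) UNIV"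
  proof (rule norm_summable_imp_has_sum)
    show s: "summable (\<lambda>n. norm ((real n + 1/2) powr (-3/2)))"
    proof (rule summable_comparison_test)
      have "summable (\<lambda>n. of_nat n powr (-3/2) :: real)"
        by (subst summable_real_powr_iff) auto
      hence "summable (\<lambda>n. real (Suc n) powr (-3/2))"
        by (subst summable_Suc_iff)
      thus "summable (\<lambda>n. (1/2) powr (-3/2) * real (Suc n) powr (-3/2))"
        by (rule summable_mult)
      \<comment> \<open>Comparing with \<open>real n\<close> itself would fail at n = 0, where
        \<open>powr\<close> returns 0; hence the bound n + 1/2 >= (n + 1)/2.\<close>
      have "(real n + 1/2) powr (-3/2) \<le> (1/2 * real (Suc n)) powr (-3/2)" for n
        by (rule powr_mono2') auto
      thus "\<exists>N. \<forall>n\<ge>N. norm (norm ((real n + 1/2) powr (-3/2))) \<le> (1/2) powr (-3/2) * real (Suc n) powr (-3/2)"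
        by (simp only: powr_mult) auto
    qed
    show "(\<lambda>n. (real n + 1/2) powr (-3/2)) sums (\<Sum>n. (real n + 1/2) powr (-3/2))"
      using summable_norm_cancel[OF s] by (rule summable_sums)
  qed
  moreover have "\<bar>real_of_int (int n) + 1/2\<bar> = real n + 1/2" "\<bar>real_of_int (- 1 - int n) + 1/2\<bar> = real n + 1/2" for n
    by auto
  ultimately show ?thesis
    by (intro has_sum_imp_summable[OF has_sum_int]) simp_all
qed

lemma summable_on_product_real:
  fixes f :: "'a \<Rightarrow> real" and g :: "'b \<Rightarrow> real"
  assumes "f summable_on A" "g summable_on B" "\<And>x. f x \<ge> 0" "\<And>y. g y \<ge> 0"
  shows "(\<lambda>(x, y). f x * g y) summable_on (A \<times> B)"
proof (rule summable_on_SigmaI)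
  show "((\<lambda>y. case (x, y) of (x, y) \<Rightarrow> f x * g y) has_sum f x * infsum g B) B" for x
    by (simp add: has_sum_cmult_right has_sum_infsum[OF assms(2)])
  show "(\<lambda>x. f x * infsum g B) summable_on A"
    by (rule summable_on_cmult_left[OF assms(1)])
qed (use assms in auto)

definition half_lattice :: "complex \<Rightarrow> int \<Rightarrow> int \<Rightarrow> complex" where
  "half_lattice \<tau> n m = (of_int n + 1/2) + (of_int m + 1/2) * \<tau>"

text \<open>The imaginary part controls m + 1/2. Then n + 1/2 is the lattice point minus (m + 1/2) *
  \<tau>, so the triangle inequality controls it at the cost of the factor 1 + |\<tau>| / Im
  \<tau>.\<close>

lemma half_lattice_lower_bound:
  assumes "Im \<tau> > 0"
  obtains c where "c > 0" "\<And>n m. c * \<bar>of_int n + 1/2\<bar> \<le> norm (half_lattice \<tau> n m)"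
    "\<And>n m. c * \<bar>of_int m + 1/2\<bar> \<le> norm (half_lattice \<tau> n m)"
proof -
  define d where "d = 1 + norm \<tau> / Im \<tau>"
  have d: "d > 0" using assms by (simp add: d_def add_pos_nonneg)
  have M: "Im \<tau> * \<bar>of_int m + 1/2\<bar> \<le> norm (half_lattice \<tau> n m)" for n m
  proof -
    have "Im (half_lattice \<tau> n m) = (of_int m + 1/2) * Im \<tau>"
      by (simp add: half_lattice_def)
    thus ?thesis using abs_Im_le_cmod[of "half_lattice \<tau> n m"] assms by (simp add: abs_mult mult_ac)
  qed
  have N: "inverse d * \<bar>of_int n + 1/2\<bar> \<le> norm (half_lattice \<tau> n m)" for n m
  proof -
    have a: "norm ((of_int m + 1/2) * \<tau>) = \<bar>of_int m + 1/2\<bar> * norm \<tau>"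
      using norm_of_real[of "of_int m + 1/2", where ?'a = complex] by (simp add: norm_mult)
    have "\<bar>of_int n + 1/2\<bar> = norm (of_int n + 1/2 :: complex)"
      using norm_of_real[of "of_int n + 1/2", where ?'a = complex] by simp
    also have "\<dots> = norm (half_lattice \<tau> n m - (of_int m + 1/2) * \<tau>)"
      by (simp add: half_lattice_def)
    also have "\<dots> \<le> norm (half_lattice \<tau> n m) + \<bar>of_int m + 1/2\<bar> * norm \<tau>"
      using norm_triangle_ineq4 a by metis
    also have "\<bar>of_int m + 1/2\<bar> * norm \<tau> = (Im \<tau> * \<bar>of_int m + 1/2\<bar>) * (norm \<tau> / Im \<tau>)"
      using assms by simp
    also have "\<dots> \<le> norm (half_lattice \<tau> n m) * (norm \<tau> / Im \<tau>)"
      using M[of m n] by (rule mult_right_mono) (use assms in auto)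
    finally have "\<bar>of_int n + 1/2\<bar> \<le> norm (half_lattice \<tau> n m) * d"
      by (simp add: d_def algebra_simps)
    thus ?thesis using d by (simp add: field_simps)
  qed
  show ?thesis
  proof (rule that[of "min (Im \<tau>) (inverse d)"])
    fix n m :: int
    have "min (Im \<tau>) (inverse d) * \<bar>of_int n + 1/2\<bar> \<le> inverse d * \<bar>of_int n + 1/2\<bar>"
      by (intro mult_right_mono) auto
    thus "min (Im \<tau>) (inverse d) * \<bar>of_int n + 1/2\<bar> \<le> norm (half_lattice \<tau> n m)"
      using N[of n m] by linarith
    have "min (Im \<tau>) (inverse d) * \<bar>of_int m + 1/2\<bar> \<le> Im \<tau> * \<bar>of_int m + 1/2\<bar>"
      by (intro mult_right_mono) auto
    thus "min (Im \<tau>) (inverse d) * \<bar>of_int m + 1/2\<bar> \<le> norm (half_lattice \<tau> n m)"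
      using M[of m n] by linarith
  qed (use assms d in auto)
qed

text \<open>The numerator of the difference is z * (z + 2w) up to sign, with |z + 2w| <= 5/2 * |w|,
  and |z + w| >= |w|/2 costs a factor 4: together 10.\<close>

lemma norm_inverse_square_diff_le:
  fixes z w :: complex
  assumes "2 * norm z \<le> norm w" "w \<noteq> 0"
  shows "norm (1 / (z + w)\<^sup>2 - 1 / w\<^sup>2) \<le> 10 * norm z / norm w ^ 3"
proof -
  have w: "norm w > 0" using assms by simp
  have h: "norm w / 2 \<le> norm (z + w)"
    using norm_triangle_ineq2[of w "- z"] assms by (simp add: add.commute)
  hence "z + w \<noteq> 0" using w by auto
  hence "1 / (z + w)\<^sup>2 - 1 / w\<^sup>2 = - (z * (z + 2 * w)) / ((z + w)\<^sup>2 * w\<^sup>2)"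
    using assms(2) by (simp add: field_simps) (simp add: power2_eq_square algebra_simps)
  hence "norm (1 / (z + w)\<^sup>2 - 1 / w\<^sup>2) = norm z * norm (z + 2 * w) / (norm (z + w) ^ 2 * norm w ^ 2)"
    by (simp add: norm_divide norm_mult norm_power)
  also have "\<dots> \<le> norm z * (5/2 * norm w) / ((norm w / 2) ^ 2 * norm w ^ 2)"
  proof (intro frac_le mult_mono power_mono h)
    show "norm (z + 2 * w) \<le> 5/2 * norm w"
      using norm_triangle_ineq[of z "2 * w"] assms by (simp add: norm_mult)
  qed (use w in auto)
  also have "\<dots> = 10 * norm z / norm w ^ 3"
    using w by (simp add: field_simps power2_eq_square power3_eq_cube)
  finally show ?thesis .
qed

text \<open>
  Away from finitely many points the summand is \<open>O(1 / norm w ^ 3)\<close>, and \<open>norm w\<close> dominates both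
  half-integer coordinates of \<open>w\<close>, so a product of two one-dimensional sums with exponent \<open>3/2\<close>
  is a majorant.
\<close>
lemma half_lattice_summable:
  assumes "Im \<tau> > 0"
  shows "(\<lambda>(n, m). 1 / (z + half_lattice \<tau> n m)\<^sup>2 - 1 / (half_lattice \<tau> n m)\<^sup>2) summable_on UNIV"
    (is "?f summable_on _")
proof -
  obtain c where c: "c > 0" "\<And>n m. c * \<bar>of_int n + 1/2\<bar> \<le> norm (half_lattice \<tau> n m)"
    "\<And>n m. c * \<bar>of_int m + 1/2\<bar> \<le> norm (half_lattice \<tau> n m)"
    using half_lattice_lower_bound[OF assms] by blast
  define B where "B = {(n, m). norm (half_lattice \<tau> n m) < 2 * norm z}"
  have half: "\<bar>of_int n + 1/2 :: real\<bar> > 0" for n :: int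
  proof -
    have "of_int n + 1/2 \<noteq> (0 :: real)"
    proof
      assume "of_int n + 1/2 = (0 :: real)"
      hence "of_int (2 * n + 1) = (0 :: real)" by simp
      hence "2 * n + 1 = 0" by (simp only: of_int_eq_0_iff)
      thus False by presburger
    qed
    thus ?thesis by simp
  qed
  have "finite B"
  proof (rule finite_subset)
    define K where "K = \<lceil>2 * norm z / c\<rceil> + 1"
    have "\<bar>n\<bar> \<le> K" if "c * \<bar>of_int n + 1/2\<bar> < 2 * norm z" for n
    proof -
      have "\<bar>of_int n + 1/2\<bar> < 2 * norm z / c" using that c(1) by (simp add: field_simps)
      thus ?thesis unfolding K_def by linarith
    qed
    hence "\<bar>n\<bar> \<le> K \<and> \<bar>m\<bar> \<le> K" if "(n, m) \<in> B" for n m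
      using that c(2)[of n m] c(3)[of m n] unfolding B_def by force
    thus "B \<subseteq> {-K..K} \<times> {-K..K}" by fastforce
  qed auto
  have "?f summable_on - B"
  proof (rule abs_summable_summable[OF Infinite_Sum.abs_summable_on_comparison_test'[where f = ?f]])
    let ?g = "\<lambda>n::int. \<bar>of_int n + 1/2 :: real\<bar> powr (-3/2)"
    have "(\<lambda>(n, m). ?g n * ?g m) summable_on (UNIV \<times> UNIV)"
      by (intro summable_on_product_real summable_on_int_powr) auto
    hence "(\<lambda>(n, m). ?g n * ?g m) summable_on - B"
      by (rule summable_on_subset_banach) auto
    thus "(\<lambda>p. 10 * norm z * c powr (-3) * (case p of (n, m) \<Rightarrow> ?g n * ?g m)) summable_on - B"
      by (rule summable_on_cmult_right)
    fix p assume p: "p \<in> - B"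
    obtain n m where nm: "p = (n, m)" by force
    define w where "w = half_lattice \<tau> n m"
    have w: "2 * norm z \<le> norm w" using p by (simp add: nm B_def w_def)
    have w0: "norm w > 0" using c(2)[of n m] c(1) half[of n] mult_pos_pos unfolding w_def
      by (meson less_le_trans)
    have "norm w powr (-3) = norm w powr (-3/2) * norm w powr (-3/2)"
      by (simp flip: powr_add)
    also have "\<dots> \<le> (c * \<bar>of_int n + 1/2\<bar>) powr (-3/2) * (c * \<bar>of_int m + 1/2\<bar>) powr (-3/2)"
      by (intro mult_mono powr_mono2') (use c half in \<open>auto simp: w_def\<close>)
    also have "\<dots> = (c powr (-3/2) * c powr (-3/2)) * (?g n * ?g m)"
      using c(1) by (simp add: powr_mult)
    also have "c powr (-3/2) * c powr (-3/2) = c powr (-3)"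
      by (simp flip: powr_add)
    finally have b: "norm w powr (-3) \<le> c powr (-3) * (?g n * ?g m)" .
    have "norm (?f p) \<le> 10 * norm z / norm w ^ 3"
      using norm_inverse_square_diff_le[OF w] w0 by (simp add: nm w_def)
    also have "\<dots> = 10 * norm z * norm w powr (-3)"
      using w0 by (simp add: powr_minus powr_numeral divide_inverse)
    also have "\<dots> \<le> 10 * norm z * (c powr (-3) * (?g n * ?g m))"
      using b by (rule mult_left_mono) auto
    finally show "norm (?f p) \<le> 10 * norm z * c powr (-3) * (case p of (n, m) \<Rightarrow> ?g n * ?g m)"
      by (simp add: nm mult_ac)
  qed
  moreover have "?f summable_on B" using \<open>finite B\<close> by simp
  ultimately have "?f summable_on (- B \<union> B)" by (rule summable_on_Un_disjoint) auto
  thus ?thesis by simp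
qed

lemma has_sum_diff_complex:
  fixes f g :: "'a \<Rightarrow> complex"
  assumes "(f has_sum a) A" "(g has_sum b) A"
  shows "((\<lambda>x. f x - g x) has_sum (a - b)) A"
  using has_sum_add[OF assms(1) has_sum_uminusI[OF assms(2)]] by simp

text \<open>Row m contributes the Koebe function at x * s^(2m+1), minus its value for x = 1. Rows m
  >= 0 give the argument x * s; rows m < 0 are inverted by \<open>koebe_inverse\<close> and give s /
  x. For x = 1 both halves coincide, whence the factor 2.\<close>

lemma wp_tilde_eq_koebe_series:
  fixes \<tau> z :: complex
  defines "s \<equiv> exp (\<i> * of_real pi * \<tau>)" and "x \<equiv> exp (2 * \<i> * of_real pi * z)"
  assumes \<tau>: "Im \<tau> > 0"
    and z: "z \<notin> {(1 + \<tau>) / 2 + of_int a + \<tau> * of_int b | a b :: int. True}"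
  shows "wp_tilde \<tau> z =
    4 * of_real pi ^ 2 * (koebe_series (s\<^sup>2) (x * s) + koebe_series (s\<^sup>2) (s / x) - 2 * koebe_series (s\<^sup>2) s)"
proof -
  define f where "f = (\<lambda>(n, m). 1 / (z + half_lattice \<tau> n m)\<^sup>2 - 1 / (half_lattice \<tau> n m)\<^sup>2)"
  define e where "e = (\<lambda>m::int. exp (2 * \<i> * of_real pi * ((of_int m + 1/2) * \<tau>)))"
  define b where "b = (\<lambda>m::int. 4 * of_real pi ^ 2 * (koebe (x * e m) - koebe (e m)))"
  have "norm s = exp (- (pi * Im \<tau>))" by (simp add: s_def norm_exp)
  hence q: "norm (s\<^sup>2) < 1" using \<tau> by (intro norm_power2_less_one) simp
  have row: "((\<lambda>n. 1 / (w + half_lattice \<tau> n m)\<^sup>2) has_sum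
      4 * of_real pi ^ 2 * koebe (exp (2 * \<i> * of_real pi * w) * e m)) UNIV"
    if "w + half_lattice \<tau> 0 m \<notin> \<int>" for w m
  proof -
    let ?u = "w + half_lattice \<tau> 0 m"
    \<comment> \<open>The summand 1/2 of \<open>half_lattice\<close> contributes exp(i * pi) = -1,
      which cancels the minus sign.\<close>
    have "- exp (2 * \<i> * (of_real pi * ?u)) = exp (2 * \<i> * of_real pi * w) * e m"
      by (simp add: e_def half_lattice_def algebra_simps exp_add)
    hence "of_real pi ^ 2 / sin (of_real pi * ?u) ^ 2 =
        4 * of_real pi ^ 2 * koebe (exp (2 * \<i> * of_real pi * w) * e m)"
      using inverse_sin_squared_eq_koebe[of "of_real pi * ?u"] by (simp add: divide_inverse)
    thus ?thesis
      using has_sum_inverse_square_int[OF that] by (simp add: half_lattice_def add_ac)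
  qed
  have nz: "z + half_lattice \<tau> 0 m \<notin> \<int>" for m
  proof
    assume "z + half_lattice \<tau> 0 m \<in> \<int>"
    then obtain k :: int where "z + half_lattice \<tau> 0 m = of_int k" by (auto elim: Ints_cases)
    hence "z = (1 + \<tau>) / 2 + of_int (k - 1) + \<tau> * of_int (- m - 1)"
      by (simp add: half_lattice_def field_simps)
    thus False using z by blast
  qed
  have n0: "0 + half_lattice \<tau> 0 m \<notin> \<int>" for m
  proof
    assume "0 + half_lattice \<tau> 0 m \<in> \<int>"
    hence "Im (half_lattice \<tau> 0 m) = 0" by (auto elim!: Ints_cases)
    hence "of_int m + 1/2 = (0 :: real)" using \<tau> by (simp add: half_lattice_def)
    hence "of_int (2 * m + 1) = (0 :: real)" by simp
    hence "2 * m + 1 = 0" by (simp only: of_int_eq_0_iff)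
    thus False by presburger
  qed
  have rowsum: "((\<lambda>n. f (n, m)) has_sum b m) UNIV" for m
    using has_sum_diff_complex[OF row[OF nz, of m] row[OF n0, of m]]
    by (simp add: f_def b_def x_def algebra_simps)
  have "((\<lambda>(m, n). f (n, m)) has_sum wp_tilde \<tau> z) (UNIV \<times> UNIV)"
  proof -
    have "wp_tilde \<tau> z = infsum f UNIV"
      by (simp add: wp_tilde_def f_def half_lattice_def add.assoc)
    hence "(f has_sum wp_tilde \<tau> z) (UNIV \<times> UNIV)"
      using half_lattice_summable[OF \<tau>, of z] by (simp add: f_def)
    \<comment> \<open>The inner sum must run over n for fixed m, opposite to the order of the pairs
      in \<open>wp_tilde\<close>.\<close>
    thus ?thesis by (subst (asm) has_sum_swap)
  qed
  hence "(b has_sum wp_tilde \<tau> z) UNIV"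
    by (rule has_sum_Sigma') (simp add: rowsum)
  moreover have "(b has_sum 4 * of_real pi ^ 2 * ((koebe_series (s\<^sup>2) (x * s) + koebe_series (s\<^sup>2) (s / x)) -
      (koebe_series (s\<^sup>2) s + koebe_series (s\<^sup>2) s))) UNIV"
  proof -
    have e1: "e (int n) = s * (s\<^sup>2) ^ n" for n
      unfolding e_def s_def by (simp add: exp_of_nat_mult[symmetric] exp_add[symmetric] algebra_simps)
    have e2: "e (- 1 - int n) = inverse (s * (s\<^sup>2) ^ n)" for n
      unfolding e1[symmetric] unfolding e_def exp_minus[symmetric] by (simp add: algebra_simps)
    have "((\<lambda>m. koebe (y * e m)) has_sum (koebe_series (s\<^sup>2) (y * s) + koebe_series (s\<^sup>2) (s / y))) UNIV"
      if "y \<noteq> 0" for y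
    proof (rule has_sum_int)
      show "((\<lambda>n. koebe (y * e (int n))) has_sum koebe_series (s\<^sup>2) (y * s)) UNIV"
        using has_sum_koebe_series[OF q, of "y * s"] by (simp add: e1 mult_ac)
      have "koebe (y * e (- 1 - int n)) = koebe (s / y * (s\<^sup>2) ^ n)" for n
      proof -
        have "y * e (- 1 - int n) = inverse (s / y * (s\<^sup>2) ^ n)" by (simp add: e2 field_simps)
        thus ?thesis by (simp only: koebe_inverse)
      qed
      thus "((\<lambda>n. koebe (y * e (- 1 - int n))) has_sum koebe_series (s\<^sup>2) (s / y)) UNIV"
        using has_sum_koebe_series[OF q, of "s / y"] by simp
    qed
    from this[of x] this[of 1] show ?thesis
      unfolding b_def by (intro has_sum_cmult_right has_sum_diff_complex) (auto simp: x_def)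
  qed
  ultimately show ?thesis by (simp add: has_sum_unique)
qed

subsection \<open>Doubly periodic functions without poles\<close>

text \<open>
  The symmetry about \<open>p\<close> turns the hypothesis that the pole there has order less than two into
  holomorphy: an even function has no simple pole.
\<close>
lemma elliptic_constant:
  fixes f :: "complex \<Rightarrow> complex" and p \<tau> :: complex
  defines "P \<equiv> {p + of_int a + \<tau> * of_int b | a b :: int. True}"
  assumes \<tau>: "Im \<tau> > 0"
    and per1: "\<And>z. f (z + 1) = f z" and per\<tau>: "\<And>z. f (z + \<tau>) = f z"
    and ana: "\<And>z. z \<notin> P \<Longrightarrow> f analytic_on {z}"
    and sym: "\<And>z. f (2 * p - z) = f z"
    and lim: "((\<lambda>z. (z - p)\<^sup>2 * f z) \<longlongrightarrow> 0) (at p)"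
  obtains c where "\<And>z. z \<notin> P \<Longrightarrow> f z = c"
proof -
  \<comment> \<open>A nonzero lattice vector has norm at least Im \<tau> if b is nonzero and at
    least 1 otherwise, so distinct points of \<open>P\<close> are at least \<open>\<delta>\<close>
    apart.\<close>
  define \<delta> where "\<delta> = min 1 (Im \<tau>)"
  have \<delta>: "\<delta> > 0" using \<tau> by (simp add: \<delta>_def)
  have sep: "of_int a + \<tau> * of_int b = (0 :: complex)" if "norm (of_int a + \<tau> * of_int b) < \<delta>" for a b :: int
  proof -
    have "\<bar>real_of_int b\<bar> * Im \<tau> \<le> norm (of_int a + \<tau> * of_int b)"
      using abs_Im_le_cmod[of "of_int a + \<tau> * of_int b"] \<tau> by (simp add: abs_mult mult_ac)
    also have "\<dots> < 1 * Im \<tau>"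
      using that by (simp add: \<delta>_def)
    finally have "\<bar>real_of_int b\<bar> * Im \<tau> < 1 * Im \<tau>" .
    hence "\<bar>real_of_int b\<bar> < 1" using \<tau> by (simp only: mult_less_cancel_right_pos)
    hence b: "b = 0" by linarith
    hence "\<bar>real_of_int a\<bar> < 1" using that by (simp add: \<delta>_def)
    hence "a = 0" by linarith
    with b show ?thesis by simp
  qed
  have eqP: "y = x" if "x \<in> P" "y \<in> P" "dist y x < \<delta>" for x y
  proof -
    from that obtain a b a' b' where *: "x = p + of_int a + \<tau> * of_int b" "y = p + of_int a' + \<tau> * of_int b'"
      unfolding P_def by blast
    hence "y - x = of_int (a' - a) + \<tau> * of_int (b' - b)" by (simp add: algebra_simps)
    hence "y - x = 0" using sep that(3) unfolding dist_norm by metis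
    thus ?thesis by simp
  qed
  have "p \<in> P" unfolding P_def by (intro CollectI exI[of _ 0]) auto
  have openP: "open (- P)"
    using discrete_imp_closed[OF \<delta>, of P] eqP by (auto simp: open_Compl)
  define B where "B = ball p \<delta>"
  have offP: "z \<notin> P" if "z \<in> B" "z \<noteq> p" for z
    using that eqP[OF \<open>p \<in> P\<close>, of z] by (auto simp: B_def dist_commute)
  have fdiff: "f field_differentiable at z" if "z \<notin> P" for z
    using ana[OF that] analytic_on_imp_differentiable_at by blast

  \<comment> \<open>The limit hypothesis makes the value 0 at p the continuous one, so the
    singularity of \<open>G\<close> is removable.\<close>
  define G where "G = (\<lambda>z. if z = p then 0 else (z - p)\<^sup>2 * f z)"
  have "G holomorphic_on B"
  proof (rule no_isolated_singularity[of _ _ "{p}"])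
    have "G holomorphic_on B - {p} \<longleftrightarrow> (\<lambda>z. (z - p)\<^sup>2 * f z) holomorphic_on B - {p}"
      by (rule holomorphic_cong) (auto simp: G_def)
    moreover have "f holomorphic_on B - {p}"
      using offP by (auto simp: holomorphic_on_def intro!: field_differentiable_at_within fdiff)
    ultimately show *: "G holomorphic_on B - {p}"
      by (auto intro!: holomorphic_intros)
    show "continuous_on B G"
    proof (rule continuous_at_imp_continuous_on, rule ballI)
      fix z assume z: "z \<in> B"
      show "isCont G z"
      proof (cases "z = p")
        case True
        have "(G \<longlongrightarrow> 0) (at p)"
          using lim by (rule Lim_transform_eventually) (auto simp: G_def eventually_at_filter)
        thus ?thesis by (simp add: True isCont_def G_def)
      next
        case False
        moreover have "open (B - {p})" by (auto simp: B_def)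
        ultimately show ?thesis
          using holomorphic_on_imp_continuous_on[OF *] z
          by (simp add: continuous_on_eq_continuous_at)
      qed
    qed
  qed (auto simp: B_def)
  have "open B" "p \<in> B" using \<delta> by (auto simp: B_def)
  have Gsym: "G (2 * p - z) = G z" for z
  proof -
    have "(2 * p - z - p)\<^sup>2 = (z - p)\<^sup>2" by (simp add: power2_eq_square algebra_simps)
    moreover have "2 * p - z = p \<longleftrightarrow> z = p" by (auto simp: algebra_simps)
    ultimately show ?thesis by (simp add: G_def sym)
  qed
  \<comment> \<open>By \<open>Gsym\<close> the derivative at p equals its own negative. Hence
    \<open>G\<close> vanishes to second order at p and can be divided by z - p twice, which yields
    \<open>g\<close>.\<close>
  have "deriv G p = 0"
  proof -
    have D: "(G has_field_derivative deriv G p) (at p)"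
      using holomorphic_derivI[OF \<open>G holomorphic_on B\<close> \<open>open B\<close> \<open>p \<in> B\<close>] .
    have "((\<lambda>z. G (2 * p - z)) has_field_derivative deriv G p * (- 1)) (at p)"
      by (rule DERIV_chain2[where f = G]) (use D in \<open>auto intro!: derivative_eq_intros\<close>)
    hence "deriv G p = deriv G p * (- 1)"
      using D DERIV_unique unfolding Gsym by blast
    thus ?thesis by simp
  qed
  define G1 where "G1 = (\<lambda>z. if z = p then deriv G p else (G z - G p) / (z - p))"
  define g where "g = (\<lambda>z. if z = p then deriv G1 p else (G1 z - G1 p) / (z - p))"
  have "G1 holomorphic_on B" unfolding G1_def
    using \<open>G holomorphic_on B\<close> \<open>open B\<close> by (rule pole_lemma_open)
  hence holg: "g holomorphic_on B" unfolding g_def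
    using \<open>open B\<close> by (rule pole_lemma_open)
  have gf: "g z = f z" if "z \<noteq> p" for z
    using that \<open>deriv G p = 0\<close> by (simp add: g_def G1_def G_def power2_eq_square)

  have shift1: "f (z + of_int a) = f z" for z a
  proof (induction a rule: int_induct[of _ 0])
    case (step1 i) thus ?case using per1[of "z + of_int i"] by (simp add: add_ac)
  next
    case (step2 i) thus ?case using per1[of "z + of_int i - 1"] by (simp add: algebra_simps)
  qed auto
  have shift\<tau>: "f (z + \<tau> * of_int b) = f z" for z b
  proof (induction b rule: int_induct[of _ 0])
    case (step1 i) thus ?case using per\<tau>[of "z + \<tau> * of_int i"] by (simp add: algebra_simps)
  next
    case (step2 i) thus ?case using per\<tau>[of "z + \<tau> * of_int i - \<tau>"] by (simp add: algebra_simps)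
  qed auto
  have Pshift: "z + of_int a + \<tau> * of_int b \<in> P \<longleftrightarrow> z \<in> P" for z a b
  proof
    assume "z \<in> P"
    then obtain a' b' where "z = p + of_int a' + \<tau> * of_int b'" unfolding P_def by blast
    hence "z + of_int a + \<tau> * of_int b = p + of_int (a' + a) + \<tau> * of_int (b' + b)"
      by (simp add: algebra_simps)
    thus "z + of_int a + \<tau> * of_int b \<in> P" unfolding P_def by blast
  next
    assume "z + of_int a + \<tau> * of_int b \<in> P"
    then obtain a' b' where "z + of_int a + \<tau> * of_int b = p + of_int a' + \<tau> * of_int b'"
      unfolding P_def by blast
    hence "z = p + of_int (a' - a) + \<tau> * of_int (b' - b)"
      by (simp add: algebra_simps)
    thus "z \<in> P" unfolding P_def by blast
  qed
  \<comment> \<open>The values of \<open>f\<close> on \<open>P\<close> are arbitrary; they are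
    replaced by the one value that continues \<open>f\<close> at p, and periodicity carries
    differentiability from p to all of \<open>P\<close>.\<close>
  define h where "h = (\<lambda>z. if z \<in> P then g p else f z)"
  have hshift: "h (z + of_int a + \<tau> * of_int b) = h z" for z a b
    by (simp only: h_def Pshift shift1 shift\<tau>)
  have hg: "h z = g z" if "z \<in> B" for z
    using that offP[of z] \<open>p \<in> P\<close> by (cases "z = p") (auto simp: h_def gf)
  have hdiff: "h field_differentiable at z" for z
  proof (cases "z \<in> P")
    case False
    have "f holomorphic_on - P"
      by (auto simp: holomorphic_on_def intro!: field_differentiable_at_within fdiff)
    hence "h holomorphic_on - P" using holomorphic_cong[of "- P" "- P" h f] by (simp add: h_def)
    thus ?thesis using openP False holomorphic_on_imp_differentiable_at by blast
  next
    case True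
    then obtain a b where z: "z = p + of_int a + \<tau> * of_int b" unfolding P_def by blast
    define l where "l = of_int a + \<tau> * of_int b"
    have "h holomorphic_on B" using holg hg by (simp cong: holomorphic_cong)
    hence "h field_differentiable at p"
      using \<open>open B\<close> \<open>p \<in> B\<close> holomorphic_on_imp_differentiable_at by blast
    hence "(h \<circ> (\<lambda>w. w - l)) field_differentiable at z"
      by (intro field_differentiable_compose) (auto simp: z l_def intro!: derivative_intros)
    moreover have "(h \<circ> (\<lambda>w. w - l)) = h"
    proof
      fix w show "(h \<circ> (\<lambda>w. w - l)) w = h w"
        using hshift[of "w - l" a b] by (simp add: l_def algebra_simps)
    qed
    ultimately show ?thesis by simp
  qed
  hence hol: "h holomorphic_on UNIV"
    by (simp add: holomorphic_on_def field_differentiable_at_within)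
  \<comment> \<open>The closed period parallelogram; fractional parts of the real coordinates move
    every point into it.\<close>
  define K where "K = (\<lambda>(u, v). of_real u + \<tau> * of_real v) ` ({0..1} \<times> {0..1::real})"
  have "compact K" unfolding K_def
    by (intro compact_continuous_image compact_Times)
       (auto simp: case_prod_unfold intro!: continuous_intros)
  hence "compact (h ` K)"
    using holomorphic_on_imp_continuous_on[OF hol] continuous_on_subset
    by (blast intro: compact_continuous_image)
  moreover have "range h \<subseteq> h ` K"
  proof safe
    fix z
    define v where "v = Im z / Im \<tau>"
    define u where "u = Re (z - \<tau> * of_real v)"
    have z: "z = of_real u + \<tau> * of_real v"
      using \<tau> by (auto simp: complex_eq_iff u_def v_def)
    have "h z = h (of_real (frac u) + \<tau> * of_real (frac v))"
      using hshift[of "of_real (frac u) + \<tau> * of_real (frac v)" "\<lfloor>u\<rfloor>" "\<lfloor>v\<rfloor>"]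
      by (simp add: z frac_def algebra_simps)
    moreover have "of_real (frac u) + \<tau> * of_real (frac v) \<in> K"
      unfolding K_def by (intro image_eqI[of _ _ "(frac u, frac v)"]) (auto intro: less_imp_le frac_lt_1)
    ultimately show "h z \<in> h ` K" by simp
  qed
  ultimately have "bounded (range h)"
    using bounded_subset compact_imp_bounded by blast
  then obtain c where "\<And>z. h z = c"
    using Liouville_theorem[OF hol] by (auto simp: constant_on_def)
  thus ?thesis using that by (metis h_def)
qed

subsection \<open>Comparison of series and product\<close>

text \<open>
  With \<open>x = exp (2 * \<i> * pi * z)\<close> and nome \<open>s = exp (\<i> * pi * \<tau>)\<close>, this is a constant multiple of
  \<open>(\<theta>\<^sub>1(z) / \<theta>\<^sub>3(z))\<^sup>2\<close>; the factor \<open>sin (pi * z) ^ 2\<close> is hidden in \<open>qpoch (s\<^sup>2) x\<close>.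
\<close>
definition theta_quot :: "complex \<Rightarrow> complex \<Rightarrow> complex" where
  "theta_quot s x = - (qpoch (s\<^sup>2) x * qpoch (s\<^sup>2) (s\<^sup>2 / x) /
     (qpoch (s\<^sup>2) (- (x * s)) * qpoch (s\<^sup>2) (- (s / x))))\<^sup>2 / (4 * x)"

text \<open>The sum of the Koebe function over x * s^k for all odd integers k, with the negative k
  folded back by \<open>koebe_inverse\<close>.\<close>

definition bilateral_koebe :: "complex \<Rightarrow> complex \<Rightarrow> complex" where
  "bilateral_koebe s x = koebe_series (s\<^sup>2) (x * s) + koebe_series (s\<^sup>2) (s / x)"

lemma bilateral_koebe_inverse: "bilateral_koebe s (1 / x) = bilateral_koebe s x"
  by (simp add: bilateral_koebe_def mult.commute)

text \<open>The shift moves one term, \<open>koebe (x * s)\<close>, from the first series to the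
  second, where it reappears at the inverse argument.\<close>

lemma bilateral_koebe_shift:
  assumes "norm s < 1" "s \<noteq> 0" "x \<noteq> 0"
  shows "bilateral_koebe s (s\<^sup>2 * x) = bilateral_koebe s x"
proof -
  note q = norm_power2_less_one[OF assms(1)]
  have "s / (s\<^sup>2 * x) = inverse (x * s)" using assms by (simp add: field_simps power2_eq_square)
  moreover have "inverse (x * s) * s\<^sup>2 = s / x" using assms by (simp add: field_simps power2_eq_square)
  ultimately have "koebe_series (s\<^sup>2) (s / (s\<^sup>2 * x)) = koebe (x * s) + koebe_series (s\<^sup>2) (s / x)"
    using koebe_series_rec[OF q, of "inverse (x * s)"] by (simp only: koebe_inverse)
  moreover have "koebe_series (s\<^sup>2) (x * s) = koebe (x * s) + koebe_series (s\<^sup>2) (s\<^sup>2 * x * s)"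
    using koebe_series_rec[OF q, of "x * s"] by (simp add: mult_ac)
  ultimately show ?thesis by (simp add: bilateral_koebe_def)
qed

text \<open>Inversion exchanges the two factors of the denominator and changes the numerator by -x,
  since 1 - x = -x * (1 - 1/x). Squaring and the divisor 4 * x absorb this.\<close>

lemma theta_quot_inverse:
  assumes "norm s < 1" "x \<noteq> 0"
  shows "theta_quot s (1 / x) = theta_quot s x"
proof -
  note q = norm_power2_less_one[OF assms(1)]
  define N' where "N' = qpoch (s\<^sup>2) (1 / x) * qpoch (s\<^sup>2) (s\<^sup>2 * x)"
  define D where "D = qpoch (s\<^sup>2) (- (x * s)) * qpoch (s\<^sup>2) (- (s / x))"
  have N: "qpoch (s\<^sup>2) x * qpoch (s\<^sup>2) (s\<^sup>2 / x) = - x * N'"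
    using assms(2) unfolding N'_def
    by (simp add: qpoch_rec[OF q, of "1 / x"] qpoch_rec[OF q, of x] field_simps)
  have "theta_quot s (1 / x) = - (N' / D)\<^sup>2 / (4 * (1 / x))"
    by (simp add: theta_quot_def N'_def D_def mult.commute)
  moreover have "theta_quot s x = - (- x * N' / D)\<^sup>2 / (4 * x)"
    by (simp only: theta_quot_def N D_def)
  ultimately show ?thesis
    using assms(2) by (simp add: power_divide power_mult_distrib power2_eq_square mult_ac)
qed

text \<open>The numerator changes by -x and the denominator by s * x, so the quotient changes by
  -1/s; its square offsets the s^2 that enters the divisor 4 * x.\<close>

lemma theta_quot_shift:
  assumes "norm s < 1" "s \<noteq> 0" "x \<noteq> 0"
  shows "theta_quot s (s\<^sup>2 * x) = theta_quot s x"
proof -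
  note q = norm_power2_less_one[OF assms(1)]
  define N where "N = qpoch (s\<^sup>2) x * qpoch (s\<^sup>2) (s\<^sup>2 / x)"
  define N' where "N' = qpoch (s\<^sup>2) (s\<^sup>2 * x) * qpoch (s\<^sup>2) (1 / x)"
  define D where "D = qpoch (s\<^sup>2) (- (x * s)) * qpoch (s\<^sup>2) (- (s / x))"
  define D' where "D' = qpoch (s\<^sup>2) (- (s\<^sup>2 * x * s)) * qpoch (s\<^sup>2) (- (1 / (s * x)))"
  have N: "N = - x * N'"
    using assms(3) unfolding N_def N'_def
    by (simp add: qpoch_rec[OF q, of "1 / x"] qpoch_rec[OF q, of x] field_simps)
  have "- (1 / (s * x)) * s\<^sup>2 = - (s / x)" using assms by (simp add: field_simps power2_eq_square)
  hence e1: "qpoch (s\<^sup>2) (- (1 / (s * x))) = (1 + 1 / (s * x)) * qpoch (s\<^sup>2) (- (s / x))"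
    by (simp only: qpoch_rec[OF q, of "- (1 / (s * x))"]) simp
  have e2: "qpoch (s\<^sup>2) (- (x * s)) = (1 + x * s) * qpoch (s\<^sup>2) (- (s\<^sup>2 * x * s))"
    using qpoch_rec[OF q, of "- (x * s)"] by (simp add: mult_ac)
  have "(1 + x * s) * d * b = s * x * (d * ((1 + 1 / (s * x)) * b))" for b d
    using assms by (simp add: field_simps)
  hence D: "D = s * x * D'"
    unfolding D_def D'_def e1 e2 by simp
  have "s\<^sup>2 / (s\<^sup>2 * x) = 1 / x" "s / (s\<^sup>2 * x) = 1 / (s * x)"
    using assms by (simp_all add: field_simps power2_eq_square)
  hence "theta_quot s (s\<^sup>2 * x) = - (N' / D')\<^sup>2 / (4 * (s\<^sup>2 * x))"
    by (simp add: theta_quot_def N'_def D'_def)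
  moreover have "theta_quot s x = - (N / D)\<^sup>2 / (4 * x)"
    by (simp add: theta_quot_def N_def D_def)
  moreover have "N / D = - (N' / (s * D'))"
    using assms(3) by (simp add: N D)
  ultimately show ?thesis
    using assms by (simp add: power_divide power_mult_distrib)
qed

text \<open>
  The constant in front of \<open>theta_quot\<close> is forced by the double pole at \<open>x = - s\<close>. Since \<open>1 / 0 = 0\<close>,
  the invariance of both summands holds at the poles as well.
\<close>
definition defect :: "complex \<Rightarrow> complex \<Rightarrow> complex" where
  "defect s x = - (bilateral_koebe s x - bilateral_koebe s 1) / 4
     - s * (qpoch (s\<^sup>2 * s\<^sup>2) (s\<^sup>2 * s\<^sup>2) * qpoch (s\<^sup>2) s) ^ 4 * theta_quot s x"

lemma defect_one: "norm s < 1 \<Longrightarrow> defect s 1 = 0"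
  by (simp add: defect_def theta_quot_def qpoch_one norm_power2_less_one)

lemma norm_mult_power_less_one:
  fixes a q :: complex
  assumes "norm a < 1" "norm q < 1"
  shows "norm (a * q ^ n) < 1"
proof -
  have "norm a * norm q ^ n \<le> norm a * 1"
    by (intro mult_left_mono power_le_one) (use assms in auto)
  thus ?thesis using assms by (simp add: norm_mult norm_power)
qed

lemma defect_double_pole:
  assumes s: "norm s < 1" "s \<noteq> 0"
  obtains K where "isCont K (- s)" "K (- s) = 0"
    "\<And>x. x \<noteq> 0 \<Longrightarrow> x \<noteq> - s \<Longrightarrow> (1 + s / x)\<^sup>2 * defect s x = K x"
proof -
  define q where "q = s\<^sup>2"
  define C where "C = (qpoch (q * q) (q * q) * qpoch q s) ^ 4"
  note q = norm_power2_less_one[OF s(1), folded q_def]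
  \<comment> \<open>Both singular parts at x = -s sit in the index-0 terms with argument s / x.
    Splitting them off by the recurrences and multiplying by (1 + s/x)^2 leaves this regular
    expression.\<close>
  define K where "K = (\<lambda>x. - (s / x + (1 + s / x)\<^sup>2 * (koebe_series q (x * s) + koebe_series q (s / x * q) - bilateral_koebe s 1)) / 4
     + s * C * (qpoch q x * qpoch q (q / x) / (qpoch q (- (x * s)) * qpoch q (- (s / x * q))))\<^sup>2 / (4 * x))"
  have nz: "- q * q ^ n \<noteq> - 1" "q * q ^ n \<noteq> 1" for n
    using norm_mult_power_less_one[OF q q, of n] by auto
  have Qq: "qpoch q q \<noteq> 0"
    by (rule qpoch_nonzero[OF q nz(2)])
  have ss: "- s * s = - q" "s / (- s) * q = - q"
    using s by (simp_all add: q_def power2_eq_square)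
  have "K analytic_on {- s}"
    unfolding K_def
    by (intro analytic_intros koebe_series_analytic_compose qpoch_analytic_compose q)
       (use s nz Qq ss in auto)
  hence cont: "isCont K (- s)"
    by (rule analytic_at_imp_isCont)
  have "qpoch (q * q) (q * q) * qpoch q s * qpoch q (- s) = qpoch q q"
    unfolding q_def by (rule qpoch_uminus_product[OF s(1)])
  hence C: "C * qpoch q (- s) ^ 4 = qpoch q q ^ 4"
    unfolding C_def by (simp flip: power_mult_distrib)
  have "q / (- s) = - s" using s by (simp add: q_def power2_eq_square)
  \<comment> \<open>At x = -s one has s/x = -1, q/x = -s and x * s = -q: the series yields 1/4, the
    product minus 1/4 by the identity \<open>C\<close>.\<close>
  hence "K (- s) = - (- 1) / 4 + s * C * (qpoch q (- s) * qpoch q (- s) / (qpoch q q * qpoch q q))\<^sup>2 / (4 * (- s))"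
    using s ss by (simp add: K_def)
  also have "\<dots> = 1 / 4 - (C * qpoch q (- s) ^ 4) / (4 * qpoch q q ^ 4)"
    using s by (simp add: power_divide power_mult_distrib power4_eq_xxxx power2_eq_square mult_ac)
  also have "\<dots> = 0" unfolding C using Qq by simp
  finally have K0: "K (- s) = 0" .
  have "(1 + s / x)\<^sup>2 * defect s x = K x" if x: "x \<noteq> 0" "x \<noteq> - s" for x
  proof -
    define Y where "Y = 1 + s / x"
    have Y: "Y \<noteq> 0" using x by (auto simp: Y_def field_simps add_eq_0_iff)
    have L: "bilateral_koebe s x = koebe_series q (x * s) + (s / x / Y\<^sup>2 + koebe_series q (s / x * q))"
      using koebe_series_rec[OF q, of "s / x"] by (simp add: bilateral_koebe_def q_def koebe_def Y_def)
    have "qpoch q (- (s / x)) = Y * qpoch q (- (s / x * q))"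
      using qpoch_rec[OF q, of "- (s / x)"] by (simp add: Y_def)
    hence T: "theta_quot s x = - (qpoch q x * qpoch q (q / x) /
        (qpoch q (- (x * s)) * qpoch q (- (s / x * q))))\<^sup>2 / (4 * x) / Y\<^sup>2"
      by (simp add: theta_quot_def q_def power_divide power_mult_distrib mult_ac)
    have *: "Y\<^sup>2 * (- (A + (B / Y\<^sup>2 + A') - A1) / 4 - c * (- E / d / Y\<^sup>2)) =
        - (B + Y\<^sup>2 * (A + A' - A1)) / 4 + c * E / d" for A B A' A1 c d E
      using Y by (simp add: field_simps)
    show ?thesis
      unfolding defect_def K_def Y_def[symmetric] L T C_def q_def by (rule *)
  qed
  thus ?thesis using that cont K0 by blast
qed

lemma defect_eq_0:
  fixes \<tau> z :: complex
  defines "s \<equiv> exp (\<i> * of_real pi * \<tau>)"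
  assumes \<tau>: "Im \<tau> > 0"
    and z: "z \<notin> {(1 + \<tau>) / 2 + of_int a + \<tau> * of_int b | a b :: int. True}"
  shows "defect s (exp (2 * \<i> * of_real pi * z)) = 0"
proof -
  define p where "p = (1 + \<tau>) / 2"
  define ex where "ex = (\<lambda>z. exp (2 * \<i> * of_real pi * z))"
  define f where "f = (\<lambda>z. defect s (ex z))"
  have "norm s = exp (- (pi * Im \<tau>))" by (simp add: s_def norm_exp)
  hence s: "norm s < 1" "s \<noteq> 0" using \<tau> by (simp_all add: s_def)
  note q = norm_power2_less_one[OF s(1)]
  have ex0: "ex z \<noteq> 0" for z by (simp add: ex_def)
  have ex\<tau>: "ex (z + \<tau>) = s\<^sup>2 * ex z" for z
    by (simp add: ex_def s_def exp_double[symmetric] exp_add[symmetric] algebra_simps)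
  have ex1: "ex (z + 1) = ex z" for z
    using exp_two_pi_i by (simp add: ex_def distrib_left exp_add mult_ac)
  have exm: "ex (- z) = 1 / ex z" for z
    by (simp add: ex_def exp_minus inverse_eq_divide)
  have exp': "ex p = - s"
    by (simp add: ex_def p_def s_def exp_add add_divide_distrib distrib_left mult.assoc)
  have per1: "f (z + 1) = f z" and per\<tau>: "f (z + \<tau>) = f z" for z
    by (simp_all add: f_def ex1 ex\<tau> defect_def bilateral_koebe_shift theta_quot_shift s ex0)
  have even: "f (- z) = f z" for z
    by (simp add: f_def exm defect_def bilateral_koebe_inverse theta_quot_inverse s ex0)
  \<comment> \<open>Writing -1 as exp(i * pi) and comparing exponents gives 2z + (2n + 1) * \<tau> =
    1 + 2k, a point of the coset with \<tau>-index -n - 1.\<close>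
  have pole1: "z \<in> {p + of_int a + \<tau> * of_int b | a b :: int. True}"
    if "ex z * s * (s\<^sup>2) ^ n = - 1" for z n
  proof -
    have "ex z * s * (s\<^sup>2) ^ n = exp (2 * \<i> * of_real pi * z + (2 * of_nat n + 1) * (\<i> * of_real pi * \<tau>))"
    proof -
      have "(s\<^sup>2) ^ n = exp (of_nat (2 * n) * (\<i> * of_real pi * \<tau>))"
        by (simp only: s_def exp_of_nat_mult power_mult)
      thus ?thesis by (simp add: ex_def s_def algebra_simps flip: exp_add)
    qed
    hence "exp (2 * \<i> * of_real pi * z + (2 * of_nat n + 1) * (\<i> * of_real pi * \<tau>)) = exp (\<i> * of_real pi)"
      using that by simp
    then obtain k :: int where "2 * \<i> * of_real pi * z + (2 * of_nat n + 1) * (\<i> * of_real pi * \<tau>) =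
        \<i> * of_real pi + of_real (of_int (2 * k) * pi) * \<i>"
      unfolding exp_eq by blast
    hence "\<i> * of_real pi * (2 * z + (2 * of_nat n + 1) * \<tau>) = \<i> * of_real pi * (1 + 2 * of_int k)"
      by (simp add: algebra_simps)
    hence "2 * z + (2 * of_nat n + 1) * \<tau> = 1 + 2 * of_int k"
      by (subst (asm) mult_left_cancel) auto
    hence "z = p + of_int k + \<tau> * of_int (- int n - 1)"
      by (simp add: p_def field_simps)
    thus ?thesis by blast
  qed
  have pole2: "z \<in> {p + of_int a + \<tau> * of_int b | a b :: int. True}"
    if "s / ex z * (s\<^sup>2) ^ n = - 1" for z n
  proof -
    have "ex (- z) * s * (s\<^sup>2) ^ n = - 1" using that by (simp add: exm)
    from pole1[OF this] obtain a b where "- z = p + of_int a + \<tau> * of_int b" by blast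
    hence "z = - (p + of_int a + \<tau> * of_int b)" by (metis minus_minus)
    also have "\<dots> = p + of_int (- a - 1) + \<tau> * of_int (- b - 1)"
      by (simp add: p_def field_simps)
    finally have "z = p + of_int (- a - 1) + \<tau> * of_int (- b - 1)" .
    thus ?thesis by blast
  qed
  have ana: "f analytic_on {z}" if z: "z \<notin> {p + of_int a + \<tau> * of_int b | a b :: int. True}" for z
  proof -
    have ne: "ex z * s * (s\<^sup>2) ^ n \<noteq> - 1" "s / ex z * (s\<^sup>2) ^ n \<noteq> - 1" for n
      using pole1 pole2 z by blast+
    have nz: "qpoch (s\<^sup>2) (- (ex z * s)) \<noteq> 0" "qpoch (s\<^sup>2) (- (s / ex z)) \<noteq> 0"
      by (rule qpoch_nonzero[OF q]; metis ne minus_minus mult_minus_left)+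
    have "ex analytic_on {z}" unfolding ex_def by (intro analytic_intros)
    thus ?thesis
      unfolding f_def defect_def bilateral_koebe_def theta_quot_def
      by (intro analytic_intros koebe_series_analytic_compose qpoch_analytic_compose q)
         (use ne nz ex0 in auto)
  qed
  have shift: "f (2 * p - z) = f z" for z
  proof -
    \<comment> \<open>Since 2p is a period, evenness about 0 is the same as evenness about the pole
      p.\<close>
    have "2 * p - z = - z + 1 + \<tau>" by (simp add: p_def)
    thus ?thesis by (simp only: per\<tau> per1 even)
  qed
  obtain K where K: "isCont K (- s)" "K (- s) = 0"
    "\<And>x. x \<noteq> 0 \<Longrightarrow> x \<noteq> - s \<Longrightarrow> (1 + s / x)\<^sup>2 * defect s x = K x"
    using defect_double_pole[OF s] by blast
  have lim: "((\<lambda>z. (z - p)\<^sup>2 * f z) \<longlongrightarrow> 0) (at p)"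
  proof -
    \<comment> \<open>\<open>Y\<close> has a simple zero at p with derivative 2 * pi * i, so (z -
      p)^2 may be traded for Y^2, which turns \<open>f\<close> into the continuous
      \<open>K\<close>.\<close>
    define Y where "Y = (\<lambda>z. 1 + s / ex z)"
    have Yp: "Y p = 0" using s by (simp add: Y_def exp')
    have "(Y has_field_derivative 2 * \<i> * of_real pi) (at p)"
      unfolding Y_def ex_def
      by (rule derivative_eq_intros refl | simp)+
         (use exp' s in \<open>simp add: ex_def field_simps\<close>)
    hence Ylim: "((\<lambda>z. Y z / (z - p)) \<longlongrightarrow> 2 * \<i> * of_real pi) (at p)"
      by (simp add: has_field_derivative_iff Yp)
    have Ynz: "eventually (\<lambda>z. Y z / (z - p) \<noteq> 0) (at p)"
      by (rule tendsto_imp_eventually_ne[OF Ylim]) simp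
    have "isCont (\<lambda>z. K (ex z)) p"
      by (rule isCont_o2[where g = K]) (use K exp' in \<open>auto simp: ex_def intro!: continuous_intros\<close>)
    hence "((\<lambda>z. K (ex z)) \<longlongrightarrow> 0) (at p)"
      using K(2) exp' by (simp add: isCont_def)
    hence "((\<lambda>z. K (ex z) / (Y z / (z - p))\<^sup>2) \<longlongrightarrow> 0 / (2 * \<i> * of_real pi)\<^sup>2) (at p)"
      by (intro tendsto_intros Ylim) auto
    moreover have "eventually (\<lambda>z. K (ex z) / (Y z / (z - p))\<^sup>2 = (z - p)\<^sup>2 * f z) (at p)"
      using Ynz
    proof eventually_elim
      case (elim z)
      hence Y: "Y z \<noteq> 0" "z \<noteq> p" by auto
      hence "ex z \<noteq> - s" using s by (auto simp: Y_def)
      hence "K (ex z) = (Y z)\<^sup>2 * f z" using K(3)[OF ex0] by (simp add: Y_def f_def)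
      thus ?case using Y by (simp add: field_simps)
    qed
    ultimately show ?thesis by (simp add: tendsto_cong)
  qed
  obtain c where c: "\<And>z. z \<notin> {p + of_int a + \<tau> * of_int b | a b :: int. True} \<Longrightarrow> f z = c"
    using elliptic_constant[OF \<tau> per1 per\<tau> ana shift lim] by blast
  have "0 \<notin> {p + of_int a + \<tau> * of_int b | a b :: int. True}"
  proof
    assume "0 \<in> {p + of_int a + \<tau> * of_int b | a b :: int. True}"
    then obtain a b :: int where "p + of_int a + \<tau> * of_int b = 0" by force
    hence "Im (p + of_int a + \<tau> * of_int b) = 0" by simp
    hence "of_int (2 * b + 1) * Im \<tau> = 0" by (simp add: p_def algebra_simps)
    hence "of_int (2 * b + 1) = (0 :: real)" using \<tau> by simp
    hence "2 * b + 1 = 0" by (simp only: of_int_eq_0_iff)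
    thus False by presburger
  qed
  from c[OF this] have "c = 0" using defect_one[OF s(1)] by (simp add: f_def ex_def)
  thus ?thesis using c[of z] z by (simp add: f_def ex_def p_def)
qed

theorem mainTheorem8:
  fixes \<tau> z :: complex
  assumes "Im \<tau> > 0"
    and "z \<notin> {(1 + \<tau>) / 2 + of_int a + \<tau> * of_int b | a b :: int. True}"
  shows "phi z \<tau> =
    (sin (complex_of_real pi * z))\<^sup>2 * qpow \<tau> (1/2)
    * (\<Prod>n::nat. (1 - qpow \<tau> (2 * real n + 2)) ^ 4 * (1 - qpow \<tau> (real n + 1/2)) ^ 4)
    * (\<Prod>n::nat.
         ((1 - exp (2 * \<i> * complex_of_real pi * z) * qpow \<tau> (real n + 1))
           * (1 - exp (- (2 * \<i> * complex_of_real pi * z)) * qpow \<tau> (real n + 1)))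
         / ((1 + exp (2 * \<i> * complex_of_real pi * z) * qpow \<tau> (real n + 1/2))
           * (1 + exp (- (2 * \<i> * complex_of_real pi * z)) * qpow \<tau> (real n + 1/2)))) ^ 2"
proof -
  define s where "s = exp (\<i> * of_real pi * \<tau>)"
  define q where "q = s\<^sup>2"
  define x where "x = exp (2 * \<i> * of_real pi * z)"
  define C where "C = (qpoch (q * q) (q * q) * qpoch q s) ^ 4"
  define T where "T = qpoch q (x * q) * qpoch q (q / x) / (qpoch q (- (x * s)) * qpoch q (- (s / x)))"
  have "norm s = exp (- (pi * Im \<tau>))" by (simp add: s_def norm_exp)
  hence s: "norm s < 1" using assms(1) by simp
  have q: "norm q < 1" unfolding q_def by (rule norm_power2_less_one[OF s])
  have qq: "norm (q * q) < 1"
    using norm_power2_less_one[OF q] by (simp add: power2_eq_square)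
  have x0: "x \<noteq> 0" by (simp add: x_def)
  have xm: "exp (- (2 * \<i> * of_real pi * z)) = 1 / x"
    by (simp add: x_def exp_minus inverse_eq_divide)
  have qn: "q ^ n = exp (of_nat (2 * n) * (\<i> * of_real pi * \<tau>))" for n
    by (simp only: q_def s_def exp_of_nat_mult power_mult)
  have p0: "qpow \<tau> (1/2) = s" by (simp add: qpow_def s_def mult.commute mult.left_commute)
  have p1: "qpow \<tau> (real n + 1/2) = s * q ^ n" for n
    unfolding qn s_def exp_add[symmetric] qpow_def by (simp add: algebra_simps)
  have p2: "qpow \<tau> (real n + 1) = q * q ^ n" for n
  proof -
    have "q * q ^ n = q ^ (n + 1)" by simp
    thus ?thesis unfolding qn qpow_def by (simp add: algebra_simps)
  qed
  have p3: "qpow \<tau> (2 * real n + 2) = (q * q) * (q * q) ^ n" for n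
  proof -
    have "(q * q) * (q * q) ^ n = q ^ (2 * n + 2)"
      by (simp add: power_mult power2_eq_square power_mult_distrib mult_ac)
    thus ?thesis unfolding qn qpow_def by (simp add: algebra_simps)
  qed
  note conv = convergent_prod_qpoch
  have "(\<Prod>n. (1 - qpow \<tau> (2 * real n + 2)) ^ 4 * (1 - qpow \<tau> (real n + 1/2)) ^ 4) = C"
    unfolding p1 p3 C_def qpoch_def power_mult_distrib[symmetric]
    by (subst prodinf_power) (intro convergent_prod_mult conv q qq,
        subst prodinf_mult, intro conv qq, intro conv q, simp)
  moreover have "(\<Prod>n. ((1 - x * (q * q ^ n)) * (1 - 1 / x * (q * q ^ n))) /
      ((1 + x * (s * q ^ n)) * (1 + 1 / x * (s * q ^ n)))) = T"
  proof -
    have "T = (\<Prod>n. ((1 - x * q * q ^ n) * (1 - q / x * q ^ n)) /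
        ((1 - (- (x * s)) * q ^ n) * (1 - (- (s / x)) * q ^ n)))"
      unfolding T_def qpoch_def
      by (simp only: prodinf_mult prodinf_divide convergent_prod_mult conv[OF q])
    thus ?thesis by (simp add: mult_ac)
  qed
  moreover have "phi z \<tau> = s * C * theta_quot s x"
  proof -
    \<comment> \<open>The factor -1/4 is -1/(16 pi^2) times the 4 pi^2 of the row sums; the
      subtracted constant is the bilateral series at x = 1.\<close>
    have "phi z \<tau> = - (bilateral_koebe s x - bilateral_koebe s 1) / 4"
      unfolding phi_def wp_tilde_eq_koebe_series[OF assms] bilateral_koebe_def s_def[symmetric] x_def[symmetric]
      by (simp add: field_simps)
    also have "\<dots> = s * C * theta_quot s x"
      using defect_eq_0[OF assms] unfolding defect_def C_def q_def s_def[symmetric] x_def[symmetric]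
      by simp
    finally show ?thesis .
  qed
  \<comment> \<open>The product in the theorem starts at x * q, whereas \<open>theta_quot\<close>
    starts at x. The extra factor 1 - x, squared and divided by -4x, is sin^2.\<close>
  moreover have "theta_quot s x = (sin (of_real pi * z))\<^sup>2 * T\<^sup>2"
  proof -
    have "exp (2 * \<i> * (of_real pi * z)) = x" by (simp add: x_def mult.assoc)
    hence "(sin (of_real pi * z))\<^sup>2 = - ((1 - x)\<^sup>2 / (4 * x))"
      by (simp add: sin_squared_conv_exp)
    moreover have "theta_quot s x = - ((1 - x) * T)\<^sup>2 / (4 * x)"
      unfolding theta_quot_def q_def[symmetric] T_def by (simp add: qpoch_rec[OF q, of x] mult.assoc)
    ultimately show ?thesis by (simp add: power_mult_distrib)
  qed
  ultimately show ?thesis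
    unfolding p0 p1 p2 xm x_def[symmetric] by (simp add: mult_ac)
qed

end
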